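(* Let $r\ge 1$, let $\mu_1<\mu_2<\dots<\mu_r$ and $a_1,\dots,a_r$ be positive integers, put $\underline{\mu}=(\mu_1,\dots,\mu_r)$, $\underline{a}=(a_1,\dots,a_r)$, and let $I=\langle\mathrm{Inc}(\mathbb{N})\cdot x_{\mu_1}^{a_1}x_{\mu_2}^{a_2}\cdots x_{\mu_r}^{a_r}\rangle\subset K[X]=K[x_j\mid j\in\mathbb{N}]$. The equivariant Hilbert series of $A=K[X]/I$ is \[ H_A(s,t)=\frac{g_{r,\underline{a},\underline{\mu}}(s,t)}{(1-t)^{\mu_r-1}\prod_{i=1}^{r}\bigl[1-s(1+t+\cdots+t^{a_i-1})\bigr]}, \] where $g_{r,\underline{a},\underline{\mu}}(s,t)\in\mathbb{Z}[s,t]$ is the polynomial with \[ g_{r,\underline{a},\underline{\mu}}(s,t)\cdot(1-t-s)=(1-t)^{\mu_r-r}\prod_{i=1}^{r}(1-t-s+st^{a_i})-s^{\mu_r}t^{\sum_{i=1}^{r}a_i}. \] Moreover, the expression \[ \frac{g_{r,\underline{a},\underline{\mu}}(s,t)}{(1-t)^{\mu_r-1}\prod_{i=1}^{r}\bigl[1-s(1+t+\cdots+t^{a_i-1})\bigr]} \] for $H_A(s,t)$ is in reduced form, that is, the given numerator and denominator are relatively prime.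
   Context: $K$ is a field, $\mathbb{N}$ is the set of positive integers, and $K[X]=K[x_j\mid j\in\mathbb{N}]$ is the standard graded polynomial ring in infinitely many variables. $\mathrm{Inc}(\mathbb{N})=\{\pi:\mathbb{N}\to\mathbb{N}\mid \pi(i)<\pi(i+1)\text{ for all } i\ge 1\}$ is the monoid of strictly increasing functions; it acts on $K[X]$ by $K$-algebra endomorphisms with $\pi\cdot x_j=x_{\pi(j)}$. For a monomial $m$, $\langle \mathrm{Inc}(\mathbb{N})\cdot m\rangle$ is the ideal of $K[X]$ generated by the orbit $\{\pi\cdot m\mid \pi\in \mathrm{Inc}(\mathbb{N})\}$. For an integer $n\ge 0$ put $K[X_n]=K[x_1,\dots,x_n]$ (so $K[X_0]=K$) and $I_n=I\cap K[X_n]$. The equivariant Hilbert series of $A=K[X]/I$ is the formal power series $H_A(s,t)=\sum_{n\ge 0,\,j\ge 0}\dim_K[K[X_n]/I_n]_j\, s^nt^j$, where $[\,\cdot\,]_j$ denotes the degree $j$ component. *)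

theory Defs
  imports
    "HOL-Library.Poly_Mapping"
    "HOL-Computational_Algebra.Polynomial"
    "HOL-Computational_Algebra.Formal_Power_Series"
    "HOL-Algebra.QuotRing"
    "HOL-Algebra.Embedded_Algebras"
begin

text \<open>
  A monomial is its exponent function \<^typ>\<open>nat \<Rightarrow>\<^sub>0 nat\<close>, and a polynomial is a finitely supported
  function from monomials to coefficients, with the convolution product of
  \<^theory>\<open>HOL-Library.Poly_Mapping\<close>. Variables are indexed from 1 on: the type also has a variable
  with index 0, and the carrier sets below leave it out.
\<close>

type_synonym 'k mpoly = "(nat \<Rightarrow>\<^sub>0 nat) \<Rightarrow>\<^sub>0 'k"

definition scalar :: "'k::comm_ring_1 \<Rightarrow> 'k mpoly" where
  "scalar c = Poly_Mapping.single 0 c"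

definition variable :: "nat \<Rightarrow> 'k::comm_ring_1 mpoly" where
  "variable j = Poly_Mapping.single (Poly_Mapping.single j 1) 1"

definition poly_ring :: "nat set \<Rightarrow> 'k::comm_ring_1 mpoly ring" where
  "poly_ring V =
     \<lparr>carrier = {p. \<forall>m \<in> Poly_Mapping.keys p. Poly_Mapping.keys m \<subseteq> V},
      mult = (*), one = 1, zero = 0, add = (+)\<rparr>"

abbreviation KX :: "'k::comm_ring_1 mpoly ring" where
  "KX \<equiv> poly_ring {1..}"

abbreviation KX_upto :: "nat \<Rightarrow> 'k::comm_ring_1 mpoly ring" where
  "KX_upto n \<equiv> poly_ring {1..n}"

definition mon_degree :: "(nat \<Rightarrow>\<^sub>0 nat) \<Rightarrow> nat" where
  "mon_degree m = (\<Sum>i \<in> Poly_Mapping.keys m. Poly_Mapping.lookup m i)"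

definition homogeneous :: "nat \<Rightarrow> 'k::comm_ring_1 mpoly \<Rightarrow> bool" where
  "homogeneous j p \<longleftrightarrow> (\<forall>m \<in> Poly_Mapping.keys p. mon_degree m = j)"

text \<open>The value of an element of \<open>Inc\<close> at 0 is unconstrained, and no variable of \<open>KX\<close> sees it.\<close>

definition Inc :: "(nat \<Rightarrow> nat) set" where
  "Inc = {\<pi>. \<forall>i\<ge>1. 1 \<le> \<pi> i \<and> \<pi> i < \<pi> (i + 1)}"

text \<open>The \<open>K\<close>-algebra endomorphism that sends the variable \<open>x\<^sub>j\<close> to \<open>x\<^bsub>\<pi>(j)\<^esub>\<close>.\<close>

definition act :: "(nat \<Rightarrow> nat) \<Rightarrow> 'k::comm_ring_1 mpoly \<Rightarrow> 'k mpoly" where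
  "act \<pi> p = (\<Sum>m \<in> Poly_Mapping.keys p. scalar (Poly_Mapping.lookup p m) *
                (\<Prod>j \<in> Poly_Mapping.keys m. variable (\<pi> j) ^ Poly_Mapping.lookup m j))"

definition Inc_ideal :: "'k::comm_ring_1 mpoly \<Rightarrow> 'k mpoly set" where
  "Inc_ideal p = Idl\<^bsub>KX\<^esub> {act \<pi> p | \<pi>. \<pi> \<in> Inc}"

definition trunc_ideal :: "'k::comm_ring_1 mpoly set \<Rightarrow> nat \<Rightarrow> 'k mpoly set" where
  "trunc_ideal I n = I \<inter> carrier (KX_upto n)"

definition trunc_quot :: "'k::comm_ring_1 mpoly set \<Rightarrow> nat \<Rightarrow> 'k mpoly set ring" where
  "trunc_quot I n = KX_upto n Quot trunc_ideal I n"

definition graded_part :: "'k::comm_ring_1 mpoly set \<Rightarrow> nat \<Rightarrow> nat \<Rightarrow> 'k mpoly set set" where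
  "graded_part I n j =
     {trunc_ideal I n +>\<^bsub>KX_upto n\<^esub> p | p. p \<in> carrier (KX_upto n) \<and> homogeneous j p}"

text \<open>The image of \<open>K\<close> in the quotient ring, over which dimensions are taken.\<close>

definition scalars :: "'k::comm_ring_1 mpoly set \<Rightarrow> nat \<Rightarrow> 'k mpoly set set" where
  "scalars I n = {trunc_ideal I n +>\<^bsub>KX_upto n\<^esub> scalar c | c. True}"

text \<open>
  Power series in \<open>s\<close> and \<open>t\<close> are power series in the outer variable \<open>s\<close> whose coefficients are
  power series in the inner variable \<open>t\<close>, and likewise for polynomials. The coefficients of the
  series are taken in \<^typ>\<open>rat\<close> because \<^typ>\<open>int\<close> has no \<^const>\<open>inverse\<close>, on which
  division of power series relies.
\<close>

definition hilbert_series :: "'k::field mpoly set \<Rightarrow> rat fps fps" where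
  "hilbert_series I =
     Abs_fps (\<lambda>n. Abs_fps (\<lambda>j.
       of_nat (ring.dim (trunc_quot I n) (scalars I n) (graded_part I n j))))"

definition var_s :: "int poly poly" where
  "var_s = [:0, 1:]"

definition var_t :: "int poly poly" where
  "var_t = [:[:0, 1:]:]"

definition bivariate_fps :: "int poly poly \<Rightarrow> rat fps fps" where
  "bivariate_fps p = Abs_fps (\<lambda>n. Abs_fps (\<lambda>j. of_int (poly.coeff (poly.coeff p n) j)))"

end

theory Submission
  imports Defs "HOL-Library.Sublist" "HOL-Computational_Algebra.Polynomial_Factorial"
begin

text \<open>
  The degree \<open>j\<close> part of \<open>K[X\<^sub>n]/I\<^sub>n\<close> has as basis the monomials outside the monomial ideal
  \<open>I\<close>. Read as the word of its exponents at \<open>x\<^sub>1, \<dots>, x\<^sub>n\<close>, a monomial lies in \<open>I\<close> iff the exponent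
  word of the generator, zeros at the unused variables included, embeds into it with respect to \<open>\<le>\<close>:
  the gaps between the \<open>\<mu>\<^sub>i\<close> become letters \<open>0\<close>, which match anything. Greedy matching,
  letter by letter, gives the generating function of the words that contain a given word as a
  product, and the Hilbert series is its complement in \<open>(1 - t) / (1 - t - s)\<close>.

  For the reduced form, \<open>g (1 - t - s) + s\<^sup>m t\<^sup>k = (1 - t) D\<close> with \<open>m = \<mu>\<^sub>r\<close>, \<open>k = \<Sum> a\<^sub>i\<close>. A common divisor of
  \<open>g\<close> and a factor \<open>1 - s(1 + \<dots> + t\<^sup>a\<^sup>-\<^sup>1)\<close> of \<open>D\<close> thus divides \<open>s\<^sup>m t\<^sup>k\<close>, to which that factor is coprime;
  and modulo \<open>1 - t\<close> the polynomial \<open>g\<close> becomes \<open>s\<^sup>m\<^sup>-\<^sup>1\<close>.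
\<close>

unbundle fps_syntax

section \<open>Generating functions of words\<close>

text \<open>Shaped like \<open>hilbert_series\<close>: a word of length \<open>n\<close> is an
  exponent vector in \<open>n\<close> variables, and its letter sum is the degree. Conditions are
  predicates, so that fixing a first letter or negating yields another such series.\<close>

definition word_gf :: "(nat list \<Rightarrow> bool) \<Rightarrow> rat fps fps" where
  "word_gf P = Abs_fps (\<lambda>n. Abs_fps (\<lambda>j.
     of_nat (card {xs. length xs = n \<and> sum_list xs = j \<and> P xs})))"

lemma finite_words: "finite {xs :: nat list. length xs = n \<and> sum_list xs = j \<and> P xs}"
proof (rule finite_subset)
  show "{xs :: nat list. length xs = n \<and> sum_list xs = j \<and> P xs}
      \<subseteq> {xs. set xs \<subseteq> {..j} \<and> length xs = n}"
    using member_le_sum_list by auto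
qed (simp add: finite_lists_length_eq)

lemma word_gf_nth_0: "word_gf P $ 0 = (if P [] then 1 else 0)"
proof (rule fps_ext)
  fix j
  have "{xs :: nat list. length xs = 0 \<and> sum_list xs = j \<and> P xs}
      = (if P [] \<and> j = 0 then {[]} else {})"
    by auto
  then show "word_gf P $ 0 $ j = (if P [] then 1 else 0) $ j"
    by (simp add: word_gf_def)
qed

text \<open>Splitting off the first letter \<open>x\<close> leaves a word of sum
  \<open>j - x\<close>; the range of \<open>x\<close> keeps this subtraction exact.\<close>

lemma word_gf_nth_Suc:
  "word_gf P $ Suc n $ j = (\<Sum>x\<le>j. word_gf (\<lambda>xs. P (x # xs)) $ n $ (j - x))"
proof -
  let ?W = "\<lambda>x. {xs. length xs = n \<and> sum_list xs = j - x \<and> P (x # xs)}"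
  have "{xs. length xs = Suc n \<and> sum_list xs = j \<and> P xs} = (\<Union>x\<le>j. (#) x ` ?W x)"
    (is "?L = _")
  proof (intro equalityI subsetI)
    fix xs assume "xs \<in> ?L"
    then show "xs \<in> (\<Union>x\<le>j. (#) x ` ?W x)"
      by (intro UN_I [of "hd xs"]; cases xs) auto
  qed auto
  moreover have "card (\<Union>x\<le>j. (#) x ` ?W x) = (\<Sum>x\<le>j. card ((#) x ` ?W x))"
    by (rule card_UN_disjoint) (auto simp: finite_words)
  moreover have "card ((#) x ` ?W x) = card (?W x)" for x
    by (rule card_image) auto
  ultimately show ?thesis
    by (simp add: word_gf_def)
qed

lemma word_gf_compl: "word_gf (\<lambda>xs. \<not> P xs) = word_gf (\<lambda>_. True) - word_gf P"
proof -
  have "card {xs :: nat list. length xs = n \<and> sum_list xs = j \<and> True}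
      = card {xs. length xs = n \<and> sum_list xs = j \<and> P xs}
        + card {xs. length xs = n \<and> sum_list xs = j \<and> \<not> P xs}" for n j
    by (subst card_Un_disjoint [symmetric])
      (auto simp: finite_words intro!: arg_cong [where f = card])
  then show ?thesis
    by (auto simp: fps_eq_iff word_gf_def simp flip: of_nat_add)
qed

abbreviation fps_s :: "rat fps fps" where "fps_s \<equiv> fps_X"
abbreviation fps_t :: "rat fps fps" where "fps_t \<equiv> fps_const fps_X"

text \<open>The finite sum enumerates the first letters below \<open>b\<close>, those that cannot
  match \<open>b\<close>.\<close>

lemma fps_nth_mult_sum_powers:
  "((\<Sum>k<b. fps_X ^ k) * (f :: 'a::comm_ring_1 fps)) $ j = (\<Sum>x\<le>j. if x < b then f $ (j - x) else 0)"
proof -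
  have "(\<Sum>k<b. fps_X ^ k :: 'a fps) $ x = (if x < b then 1 else 0)" for x
    by (simp add: fps_sum_nth)
  then show ?thesis
    by (simp add: fps_mult_nth atMost_atLeast0 if_distrib [of "\<lambda>c. c * _"] cong: if_cong)
qed

text \<open>\<open>fps_X ^ b\<close> times the geometric series enumerates the first letters that
  match \<open>b\<close>.\<close>

lemma fps_nth_mult_tail:
  "(fps_X ^ b * Abs_fps (\<lambda>_. 1) * (f :: 'a::comm_ring_1 fps)) $ j
     = (\<Sum>x\<le>j. if b \<le> x then f $ (j - x) else 0)"
proof -
  have "(fps_X ^ b * Abs_fps (\<lambda>_. 1) :: 'a fps) $ x = (if b \<le> x then 1 else 0)" for x
    by (simp add: fps_X_power_mult_nth)
  then show ?thesis
    by (simp add: fps_mult_nth atMost_atLeast0 if_distrib [of "\<lambda>c. c * _"] cong: if_cong)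
qed

lemma one_minus_t_mult_geometric: "(1 - fps_t) * fps_const (Abs_fps (\<lambda>_. 1)) = 1"
proof -
  have "(1 - fps_X) * Abs_fps (\<lambda>_. 1) = (1 :: rat fps)"
    by (simp add: fps_eq_iff fps_X_mult_nth algebra_simps)
  then show ?thesis
    by (simp flip: fps_const_1_eq_1)
qed

text \<open>Turns a recursion on word length into a functional equation.\<close>

lemma fps_eq_const_plus_X_mult:
  assumes "f $ 0 = c" "\<And>n. f $ Suc n = g $ n"
  shows "f = fps_const c + fps_X * (g :: 'a::comm_ring_1 fps)"
proof (rule fps_ext)
  fix n show "f $ n = (fps_const c + fps_X * g) $ n"
    by (cases n) (simp_all add: assms)
qed

text \<open>A nonempty word is an arbitrary letter, with series s / (1 - t), followed by an
  arbitrary word: E = 1 + s E / (1 - t).\<close>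

lemma word_gf_all: "word_gf (\<lambda>_. True) * (1 - fps_t - fps_s) = 1 - fps_t"
proof -
  define E where "E = word_gf (\<lambda>_. True)"
  \<comment> \<open>\<open>G\<close> is 1 / (1 - t). \<open>G\<close> and \<open>T\<close> stay
    folded so that the product \<open>(1 - T) * G\<close> can be recognised and replaced by
    1.\<close>
  define G :: "rat fps fps" where "G = fps_const (Abs_fps (\<lambda>_. 1))"
  define T where "T = fps_t"
  have "E $ Suc n = Abs_fps (\<lambda>_. 1) * E $ n" for n
    by (simp add: E_def fps_eq_iff word_gf_nth_Suc fps_mult_nth atMost_atLeast0)
  then have "E = 1 + fps_s * (G * E)"
    using fps_eq_const_plus_X_mult [of E 1 "G * E"]
    by (simp add: G_def E_def word_gf_nth_0)
  then have "(1 - T) * E = (1 - T) * (1 + fps_s * (G * E))"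
    by (rule arg_cong)
  also have "\<dots> = (1 - T) + fps_s * ((1 - T) * G) * E"
    by (simp add: algebra_simps)
  also have "(1 - T) * G = 1"
    unfolding T_def G_def by (rule one_minus_t_mult_geometric)
  finally show ?thesis
    unfolding E_def [symmetric] T_def [symmetric] by (simp add: algebra_simps)
qed

text \<open>Greedy matching: a word that contains \<open>b # bs\<close> has a first letter \<open>\<ge> b\<close>, and
  what follows that letter contains \<open>bs\<close>.\<close>

lemma word_gf_emb_Cons:
  "(1 - fps_t) * (1 - fps_s * (\<Sum>k<b. fps_t ^ k)) * word_gf (list_emb (\<le>) (b # bs))
     = fps_s * fps_t ^ b * word_gf (list_emb (\<le>) bs)"
proof -
  define C where "C = word_gf (list_emb (\<le>) (b # bs))"
  define C' where "C' = word_gf (list_emb (\<le>) bs)"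
  define G :: "rat fps fps" where "G = fps_const (Abs_fps (\<lambda>_. 1))"
  define T where "T = fps_t"
  let ?o = "Abs_fps (\<lambda>_. 1) :: rat fps" and ?p = "(\<Sum>k<b. fps_X ^ k) :: rat fps"
  \<comment> \<open>A letter below \<open>b\<close> is skipped. A letter that is at least
    \<open>b\<close> may always be used for \<open>b\<close>, since using a later one leaves less
    room for \<open>bs\<close>.\<close>
  have rec: "C $ Suc n = ?p * C $ n + fps_X ^ b * ?o * C' $ n" for n
  proof (rule fps_ext)
    fix j
    have "C $ Suc n $ j
        = (\<Sum>x\<le>j. (if x < b then C $ n $ (j - x) else 0) + (if b \<le> x then C' $ n $ (j - x) else 0))"
      unfolding C_def C'_def word_gf_nth_Suc by (rule sum.cong) auto
    then show "C $ Suc n $ j = (?p * C $ n + fps_X ^ b * ?o * C' $ n) $ j"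
      by (simp only: sum.distrib fps_add_nth fps_nth_mult_sum_powers fps_nth_mult_tail)
  qed
  have const: "(\<Sum>k<b. T ^ k) = fps_const ?p" "T ^ b * G = fps_const (fps_X ^ b * ?o)"
    unfolding T_def G_def by (induction b) (simp_all add: fps_const_power)
  \<comment> \<open>The constant term is 0 because the empty word does not contain
    \<open>b # bs\<close>.\<close>
  have "C = fps_s * ((\<Sum>k<b. T ^ k) * C + T ^ b * G * C')"
    unfolding const
    using fps_eq_const_plus_X_mult [of C 0 "fps_const ?p * C + fps_const (fps_X ^ b * ?o) * C'"] rec
    by (simp add: C_def word_gf_nth_0)
  then have "(1 - T) * C = (1 - T) * (fps_s * ((\<Sum>k<b. T ^ k) * C + T ^ b * G * C'))"
    by (rule arg_cong)
  also have "\<dots> = (1 - T) * (fps_s * (\<Sum>k<b. T ^ k) * C) + fps_s * T ^ b * ((1 - T) * G) * C'"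
    by (simp only: algebra_simps)
  also have "(1 - T) * G = 1"
    unfolding T_def G_def by (rule one_minus_t_mult_geometric)
  finally show ?thesis
    unfolding C_def [symmetric] C'_def [symmetric] T_def [symmetric] by (simp add: algebra_simps)
qed

text \<open>Iterates the preceding identity down to the empty word, which embeds into every
  word.\<close>

lemma word_gf_emb:
  "(\<Prod>b\<leftarrow>bs. (1 - fps_t) * (1 - fps_s * (\<Sum>k<b. fps_t ^ k))) * word_gf (list_emb (\<le>) bs)
     = fps_s ^ length bs * fps_t ^ sum_list bs * word_gf (\<lambda>_. True)"
proof (induction bs)
  case Nil
  have "list_emb (\<le>) ([] :: nat list) = (\<lambda>_. True)" by auto
  then show ?case by simp
next
  case (Cons b bs)
  let ?P = "\<Prod>b\<leftarrow>bs. (1 - fps_t) * (1 - fps_s * (\<Sum>k<b. fps_t ^ k))"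
  have "?P * ((1 - fps_t) * (1 - fps_s * (\<Sum>k<b. fps_t ^ k)) * word_gf (list_emb (\<le>) (b # bs)))
     = fps_s * fps_t ^ b * (?P * word_gf (list_emb (\<le>) bs))"
    by (subst word_gf_emb_Cons) (simp add: algebra_simps)
  then show ?case
    unfolding Cons.IH
    by (simp only: list.map prod_list.Cons sum_list.Cons list.size power_add) (simp add: algebra_simps)
qed

text \<open>The complement with all denominators cleared: both series in
  \<open>word_gf_compl\<close> are replaced by their closed forms after multiplying by 1 - t - s and
  the product.\<close>

lemma word_gf_not_emb:
  "word_gf (\<lambda>xs. \<not> list_emb (\<le>) bs xs) * (1 - fps_t - fps_s)
       * (\<Prod>b\<leftarrow>bs. (1 - fps_t) * (1 - fps_s * (\<Sum>k<b. fps_t ^ k)))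
     = (1 - fps_t) * ((\<Prod>b\<leftarrow>bs. (1 - fps_t) * (1 - fps_s * (\<Sum>k<b. fps_t ^ k)))
                      - fps_s ^ length bs * fps_t ^ sum_list bs)"
  (is "?H * ?w * ?P = _ * (_ - ?m)")
proof -
  let ?E = "word_gf (\<lambda>_. True)"
  have "?H * ?w * ?P = ?E * ?w * ?P - ?P * word_gf (list_emb (\<le>) bs) * ?w"
    by (simp only: word_gf_compl) (simp only: algebra_simps)
  also have "\<dots> = ?E * ?w * ?P - ?m * (?E * ?w)"
    by (simp only: word_gf_emb mult.assoc)
  finally show ?thesis
    by (simp only: word_gf_all) (simp only: algebra_simps)
qed

section \<open>Bivariate polynomials\<close>

lemma bivariate_fps_nth: "bivariate_fps p $ n $ j = of_int (poly.coeff (poly.coeff p n) j)"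
  by (simp add: bivariate_fps_def)

lemma bivariate_fps_diff: "bivariate_fps (p - q) = bivariate_fps p - bivariate_fps q"
  by (simp add: fps_eq_iff bivariate_fps_nth)

lemma bivariate_fps_add: "bivariate_fps (p + q) = bivariate_fps p + bivariate_fps q"
  by (simp add: fps_eq_iff bivariate_fps_nth)

lemma bivariate_fps_mult: "bivariate_fps (p * q) = bivariate_fps p * bivariate_fps q"
  by (simp add: fps_eq_iff bivariate_fps_nth fps_mult_nth coeff_mult coeff_sum fps_sum_nth
      atMost_atLeast0)

lemma bivariate_fps_0: "bivariate_fps 0 = 0"
  by (simp add: fps_eq_iff bivariate_fps_nth)

lemma bivariate_fps_1: "bivariate_fps 1 = 1"
  by (simp add: fps_eq_iff bivariate_fps_nth coeff_pCons one_pCons split: nat.split)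

lemma bivariate_fps_power: "bivariate_fps (p ^ n) = bivariate_fps p ^ n"
  by (induction n) (simp_all add: bivariate_fps_1 bivariate_fps_mult)

lemma bivariate_fps_sum: "bivariate_fps (sum f A) = (\<Sum>x\<in>A. bivariate_fps (f x))"
  by (induction A rule: infinite_finite_induct) (simp_all add: bivariate_fps_0 bivariate_fps_add)

lemma bivariate_fps_prod: "bivariate_fps (prod f A) = (\<Prod>x\<in>A. bivariate_fps (f x))"
  by (induction A rule: infinite_finite_induct) (simp_all add: bivariate_fps_1 bivariate_fps_mult)

lemma bivariate_fps_var_s: "bivariate_fps var_s = fps_X"
  by (auto simp: fps_eq_iff bivariate_fps_nth var_s_def coeff_pCons one_pCons fps_X_def split: nat.split)

lemma bivariate_fps_var_t: "bivariate_fps var_t = fps_const fps_X"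
  by (auto simp: fps_eq_iff bivariate_fps_nth var_t_def coeff_pCons fps_X_def split: nat.split)

lemmas bivariate_fps_hom = bivariate_fps_diff bivariate_fps_add bivariate_fps_mult bivariate_fps_1
  bivariate_fps_power bivariate_fps_sum bivariate_fps_prod bivariate_fps_var_s bivariate_fps_var_t

text \<open>Nonzero polynomials stay nonzero as series, so that common factors can be cancelled
  there.\<close>

lemma inj_bivariate_fps: "inj bivariate_fps"
  by (rule injI) (simp add: fps_eq_iff bivariate_fps_nth poly_eq_iff)

text \<open>The coefficients \<^typ>\<open>rat fps\<close> do not form a field, so that a denominator needs an
  invertible constant term.\<close>

lemma fps_fps_eq_divideI:
  fixes f g h :: "'a::field fps fps"
  assumes "h * g = f" "g $ 0 $ 0 \<noteq> 0"
  shows "h = f / g"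
proof -
  have nz: "g $ 0 \<noteq> 0" using assms(2) by auto
  \<comment> \<open>The constant term of \<open>g\<close> is a series in the inner variable, a unit
    because its own constant term is nonzero. A unit as constant term makes \<open>g\<close> a
    unit.\<close>
  have "g $ 0 * inverse (g $ 0) = 1"
    using assms(2) by (rule inverse_mult_eq_1')
  then have "g * inverse g = 1"
    unfolding fps_inverse_def by (rule fps_right_inverse)
  then have "h = f * inverse g"
    unfolding assms(1) [symmetric] by (simp add: mult.assoc)
  with nz show ?thesis
    by (simp add: fps_divide_unit)
qed

section \<open>Coprimality and divisibility of bivariate polynomials\<close>

lemma coprime_const_poly:
  fixes p :: "'a::idom_divide poly"
  assumes "c \<noteq> 0" "poly.coeff p i = 1"
  shows "coprime [:c:] p"
proof (rule coprimeI)
  fix q assume q: "q dvd [:c:]" "q dvd p"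
  \<comment> \<open>A divisor of a nonzero constant has degree 0, and a constant dividing
    \<open>p\<close> divides each coefficient, in particular the coefficient 1.\<close>
  from q(1) assms(1) have "degree q = 0"
    using dvd_imp_degree_le [of q "[:c:]"] by simp
  then obtain d where d: "q = [:d:]" by (rule degree_eq_zeroE)
  with q(2) have "d dvd poly.coeff p i" by (simp add: const_poly_dvd_iff)
  with assms(2) d show "is_unit q" by (simp add: is_unit_const_poly_iff)
qed

text \<open>Modulo 1 - t, t becomes 1 and 1 - t - s becomes -s, so the assumption reads g s = s^m.
  Cancelling s gives g = s^(m-1), and powers of s are coprime to 1 - t.\<close>

lemma coprime_one_minus_var_t:
  fixes g :: "int poly poly"
  assumes "1 \<le> m" "(1 - var_t) dvd g * (1 - var_t - var_s) + var_s ^ m * var_t ^ k"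
  shows "coprime g (1 - var_t)"
proof -
  let ?c = "1 - [:0, 1:] :: int poly"
  have c: "1 - var_t = [:?c:]" by (simp add: var_t_def one_pCons)
  have "(1 - var_t) dvd 1 - var_t ^ k"
    by (metis one_diff_power_eq dvd_triv_left)
  \<comment> \<open>The two multiples of 1 - t turn t^k into 1 and 1 - t - s into -s.\<close>
  then have "(1 - var_t) dvd g * (1 - var_t - var_s) + var_s ^ m * var_t ^ k
      + var_s ^ m * (1 - var_t ^ k) - (1 - var_t) * g"
    using assms(2) by (simp add: dvd_add dvd_diff)
  also have "\<dots> = var_s * (var_s ^ (m - 1) - g)"
    using assms(1) by (cases m) (simp_all add: algebra_simps)
  also have "\<dots> = pCons 0 (var_s ^ (m - 1) - g)"
    by (simp add: var_s_def)
  \<comment> \<open>\<open>?c\<close> is constant in s, so divisibility is tested on coefficients,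
    and a factor s only shifts these.\<close>
  finally have "[:?c:] dvd var_s ^ (m - 1) - g"
    unfolding c const_poly_dvd_iff by (metis coeff_pCons_Suc)
  then obtain h where "var_s ^ (m - 1) - g = [:?c:] * h" ..
  then have h: "var_s ^ (m - 1) = g + (1 - var_t) * h" unfolding c by (simp add: algebra_simps)
  have "coprime [:?c:] var_s"
    by (rule coprime_const_poly [of _ _ 1]) (simp_all add: var_s_def one_pCons)
  then have "coprime (1 - var_t) (g + (1 - var_t) * h)"
    unfolding c [symmetric] h [symmetric] by (rule coprime_power_right_iff [THEN iffD2, OF disjI1])
  then show ?thesis
    unfolding coprime_def by (metis dvd_add dvd_mult2)
qed

lemma coprime_var_s: "coprime var_s (1 - var_s * q)"
proof (rule coprimeI)
  fix d :: "int poly poly" assume d: "d dvd var_s" "d dvd 1 - var_s * q"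
  have "d dvd 1 - var_s * q + var_s * q" by (rule dvd_add [OF d(2) dvd_mult2 [OF d(1)]])
  then show "is_unit d" by (simp only: diff_add_cancel)
qed

text \<open>t is constant in s, and the coefficient of s^0 in \<open>1 - var_s * q\<close> is
  1.\<close>

lemma coprime_var_t: "coprime var_t (1 - var_s * q)"
  unfolding var_t_def
  by (rule coprime_const_poly [of _ _ 0]) (simp_all add: var_s_def)

lemma coprime_one_minus_var_s_mult:
  fixes g :: "int poly poly"
  assumes "(1 - var_s * q) dvd g * w + var_s ^ m * var_t ^ k"
  shows "coprime g (1 - var_s * q)"
proof (rule coprimeI)
  fix d assume d: "d dvd g" "d dvd 1 - var_s * q"
  have "d dvd g * w + var_s ^ m * var_t ^ k" by (rule dvd_trans [OF d(2) assms])
  then have dm: "d dvd var_s ^ m * var_t ^ k" using dvd_add_right_iff dvd_mult2 [OF d(1)] by blast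
  have cop: "coprime (var_s ^ m * var_t ^ k) (1 - var_s * q)"
    by (intro coprime_mult_left_iff [THEN iffD2] conjI coprime_power_left_iff [THEN iffD2] disjI1
        coprime_var_s coprime_var_t)
  show "is_unit d" by (rule coprime_common_divisor [OF cop dm d(2)])
qed

text \<open>As a polynomial in s, \<open>?N\<close> has the root 1 - t: there each factor becomes (1
  - t) t^(a i), and both terms equal (1 - t)^m times t to the sum of the a i.\<close>

lemma one_minus_t_minus_s_dvd:
  assumes "r \<le> m"
  shows "(1 - var_t - var_s) dvd
    (1 - var_t) ^ (m - r) * (\<Prod>i = 1..r. 1 - var_t - var_s + var_s * var_t ^ a i)
      - var_s ^ m * var_t ^ (\<Sum>i = 1..r. a i)" (is "_ dvd ?N")
proof -
  let ?c = "1 - [:0, 1:] :: int poly"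
  have t: "poly var_t ?c = [:0, 1:]" and s: "poly var_s ?c = ?c"
    by (simp_all add: var_t_def var_s_def)
  have "(\<Prod>i = 1..r. ?c * [:0, 1:] ^ a i) = ?c ^ r * [:0, 1:] ^ (\<Sum>i = 1..r. a i)"
    by (simp add: prod.distrib power_sum)
  moreover have "?c ^ m = ?c ^ (m - r) * ?c ^ r"
    using assms by (simp flip: power_add)
  ultimately have "poly ?N ?c = 0"
    by (simp only: poly_diff poly_mult poly_power poly_prod poly_add poly_1 t s) simp
  then have "[:- ?c, 1:] dvd ?N" by (simp only: poly_eq_0_iff_dvd)
  moreover have "1 - var_t - var_s = - [:- ?c, 1:]"
    by (simp add: var_t_def var_s_def one_pCons)
  ultimately show ?thesis by (simp only: minus_dvd_iff)
qed

section \<open>Orbits of monomials\<close>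

text \<open>Replaces the inductive embedding by a strictly increasing map of positions, to be
  compared with elements of \<open>Inc\<close>.\<close>

lemma list_emb_iff_strict_mono:
  "list_emb P xs ys \<longleftrightarrow>
     (\<exists>h. strict_mono_on {..<length xs} h \<and> (\<forall>i<length xs. h i < length ys \<and> P (xs ! i) (ys ! h i)))"
  (is "_ \<longleftrightarrow> (\<exists>h. ?E xs ys h)")
proof
  show "\<exists>h. ?E xs ys h" if "list_emb P xs ys"
    using that
  proof induction
    case (list_emb_Nil ys)
    then show ?case by (simp add: strict_mono_on_def)
  next
    case (list_emb_Cons xs ys y)
    then obtain h where "?E xs ys h" by blast
    then have "?E xs (y # ys) (\<lambda>i. Suc (h i))" by (simp add: strict_mono_on_def)
    then show ?case by blast
  next
    case (list_emb_Cons2 x y xs ys)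
    then obtain h where "?E xs ys h" by blast
    \<comment> \<open>\<open>x\<close> takes the new position 0, and all other positions move up by
      one.\<close>
    with list_emb_Cons2 have "?E (x # xs) (y # ys) (case_nat 0 (\<lambda>i. Suc (h i)))"
      by (auto simp: strict_mono_on_def nth_Cons split: nat.split)
    then show ?case by blast
  qed
next
  have "list_emb P xs ys" if "?E xs ys h" for h
    using that
  proof (induction ys arbitrary: xs h)
    case Nil
    then show ?case by (cases xs) auto
  next
    case (Cons y ys)
    show ?case
    proof (cases xs)
      case xs: (Cons x xs')
      have mono: "h i < h j" if "i < j" "j < length xs" for i j
        using Cons.prems that by (simp add: strict_mono_on_def)
      show ?thesis
      \<comment> \<open>Either the first letter is matched with \<open>y\<close>, or
        \<open>y\<close> is skipped. The remaining positions then move down by one.\<close>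
      proof (cases "h 0")
        case 0
        \<comment> \<open>Positivity keeps the subtraction of 1 from truncating.\<close>
        have pos: "0 < h (Suc i)" if "i < length xs'" for i
          using mono [of 0 "Suc i"] that by (simp add: xs)
        have "?E xs' ys (\<lambda>i. h (Suc i) - 1)"
        proof (intro conjI strict_mono_onI allI impI)
          fix i j assume "i \<in> {..<length xs'}" "j \<in> {..<length xs'}" "i < j"
          then show "h (Suc i) - 1 < h (Suc j) - 1"
            using mono [of "Suc i" "Suc j"] pos [of i] by (simp add: xs diff_less_mono)
        next
          fix i assume i: "i < length xs'"
          then have "h (Suc i) < length (y # ys) \<and> P (xs ! Suc i) ((y # ys) ! h (Suc i))"
            using Cons.prems xs by auto
          then show "h (Suc i) - 1 < length ys" "P (xs' ! i) (ys ! (h (Suc i) - 1))"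
            using pos [OF i] by (auto simp: xs nth_Cons')
        qed
        then have "list_emb P xs' ys" by (rule Cons.IH)
        moreover have "P x y" using Cons.prems 0 by (auto simp: xs)
        ultimately show ?thesis by (auto simp: xs)
      next
        case (Suc k)
        have pos: "0 < h i" if "i < length xs" for i
          using mono [of 0 i] that Suc by (cases "i = 0") auto
        have "?E xs ys (\<lambda>i. h i - 1)"
        proof (intro conjI strict_mono_onI allI impI)
          fix i j assume "i \<in> {..<length xs}" "j \<in> {..<length xs}" "i < j"
          then show "h i - 1 < h j - 1"
            using mono [of i j] pos [of i] by (simp add: diff_less_mono)
        next
          fix i assume i: "i < length xs"
          then have "h i < length (y # ys) \<and> P (xs ! i) ((y # ys) ! h i)"
            using Cons.prems by simp
          then show "h i - 1 < length ys" "P (xs ! i) (ys ! (h i - 1))"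
            using pos [OF i] by (auto simp: nth_Cons')
        qed
        then have "list_emb P xs ys" by (rule Cons.IH)
        then show ?thesis by auto
      qed
    qed simp
  qed
  then show "list_emb P xs ys" if "\<exists>h. ?E xs ys h" using that by blast
qed

lemma Inc_less: "\<pi> \<in> Inc \<Longrightarrow> 1 \<le> i \<Longrightarrow> i < j \<Longrightarrow> \<pi> i < \<pi> j"
proof (induction j)
  case (Suc j)
  then show ?case
    by (cases "i = j") (auto simp: Inc_def intro: less_trans)
qed simp

lemma Inc_pos: "\<pi> \<in> Inc \<Longrightarrow> 1 \<le> i \<Longrightarrow> 1 \<le> \<pi> i"
  by (simp add: Inc_def)

text \<open>List positions start at 0 and variables at 1: position \<open>i\<close> belongs to the
  variable \<open>Suc i\<close>, a shift that recurs below.\<close>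

definition exponents :: "nat \<Rightarrow> (nat \<Rightarrow>\<^sub>0 nat) \<Rightarrow> nat list" where
  "exponents n m = map (Poly_Mapping.lookup m) [1..<Suc n]"

lemma length_exponents: "length (exponents n m) = n"
  by (simp add: exponents_def)

lemma exponents_nth: "i < n \<Longrightarrow> exponents n m ! i = Poly_Mapping.lookup m (Suc i)"
  by (simp add: exponents_def del: upt_Suc)

text \<open>An embedding of words is the restriction to {1..k} of some element of
  \<open>Inc\<close>. The nonzero last exponent of \<open>b\<close> confines that restriction to
  {1..n}.\<close>

lemma ex_Inc_iff_list_emb:
  assumes "Poly_Mapping.lookup b k \<noteq> 0" "Poly_Mapping.keys b \<subseteq> {1..k}"
    and "Poly_Mapping.keys m \<subseteq> {1..n}"
  shows "(\<exists>\<pi>\<in>Inc. \<forall>j\<in>Poly_Mapping.keys b. Poly_Mapping.lookup b j \<le> Poly_Mapping.lookup m (\<pi> j))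
     \<longleftrightarrow> list_emb (\<le>) (exponents k b) (exponents n m)"
proof
  assume "\<exists>\<pi>\<in>Inc. \<forall>j\<in>Poly_Mapping.keys b. Poly_Mapping.lookup b j \<le> Poly_Mapping.lookup m (\<pi> j)"
  then obtain \<pi> where \<pi>: "\<pi> \<in> Inc"
    and le: "\<And>j. j \<in> Poly_Mapping.keys b \<Longrightarrow> Poly_Mapping.lookup b j \<le> Poly_Mapping.lookup m (\<pi> j)"
    by blast
  \<comment> \<open>Outside its keys \<open>b\<close> has exponent 0, a letter that matches
    anything.\<close>
  have le': "Poly_Mapping.lookup b j \<le> Poly_Mapping.lookup m (\<pi> j)" for j
    using le by (cases "j \<in> Poly_Mapping.keys b") (auto simp: in_keys_iff)
  \<comment> \<open>\<open>m\<close> has a nonzero exponent at \<open>\<pi> k\<close>, hence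
    \<open>\<pi> k \<le> n\<close>; monotonicity then bounds all earlier values.\<close>
  have "k \<in> Poly_Mapping.keys b" using assms(1) by (simp add: in_keys_iff)
  then have "\<pi> k \<in> Poly_Mapping.keys m"
    using le' [of k] assms(1) by (simp add: in_keys_iff)
  then have "\<pi> k \<le> n" using assms(3) by auto
  then have bound: "\<pi> (Suc i) \<le> n" if "i < k" for i
    using Inc_less [OF \<pi>, of "Suc i" k] that by (cases "Suc i = k") auto
  have suc: "Suc (\<pi> (Suc i) - 1) = \<pi> (Suc i)" for i
    using Inc_pos [OF \<pi>, of "Suc i"] by simp
  have lt: "\<pi> (Suc i) - 1 < n" if "i < k" for i
    using bound [OF that] suc [of i] by linarith
  have "strict_mono_on {..<k} (\<lambda>i. \<pi> (Suc i) - 1)"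
  proof (rule strict_mono_onI)
    fix i j assume "i \<in> {..<k}" "j \<in> {..<k}" "i < j"
    then show "\<pi> (Suc i) - 1 < \<pi> (Suc j) - 1"
      using Inc_less [OF \<pi>, of "Suc i" "Suc j"] suc [of i] suc [of j] by linarith
  qed
  moreover have "exponents n m ! (\<pi> (Suc i) - 1) = Poly_Mapping.lookup m (\<pi> (Suc i))" if "i < k" for i
    by (simp only: exponents_nth [OF lt [OF that]] suc)
  ultimately show "list_emb (\<le>) (exponents k b) (exponents n m)"
    unfolding list_emb_iff_strict_mono length_exponents
    using lt le' by (intro exI [of _ "\<lambda>i. \<pi> (Suc i) - 1"]) (simp add: exponents_nth)
next
  assume "list_emb (\<le>) (exponents k b) (exponents n m)"
  then obtain h where mono: "strict_mono_on {..<k} h"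
    and h: "\<And>i. i < k \<Longrightarrow> h i < n \<and> exponents k b ! i \<le> exponents n m ! h i"
    unfolding list_emb_iff_strict_mono length_exponents by blast
  \<comment> \<open>Up to \<open>k\<close>, positions are shifted back to indices, all at most
    \<open>n\<close>; beyond \<open>k\<close>, \<open>n + j\<close> continues strictly above
    them.\<close>
  define \<pi> where "\<pi> j = (if j \<le> k then Suc (h (j - 1)) else n + j)" for j
  have "\<pi> \<in> Inc"
    unfolding Inc_def
  proof (intro CollectI allI impI)
    fix i :: nat assume i: "1 \<le> i"
    consider "i + 1 \<le> k" | "i = k" | "k < i" by linarith
    then have "\<pi> i < \<pi> (i + 1)"
    proof cases
      case 1
      then have "h (i - 1) < h i"
        using i by (intro strict_mono_onD [OF mono]) auto
      with 1 show ?thesis by (simp add: \<pi>_def)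
    next
      case 2
      then show ?thesis using i h [of "i - 1"] by (simp add: \<pi>_def)
    qed (simp add: \<pi>_def)
    then show "1 \<le> \<pi> i \<and> \<pi> i < \<pi> (i + 1)" using i by (simp add: \<pi>_def)
  qed
  moreover have "Poly_Mapping.lookup b j \<le> Poly_Mapping.lookup m (\<pi> j)"
    if "j \<in> Poly_Mapping.keys b" for j
  proof -
    have "1 \<le> j" "j \<le> k" using that assms(2) by auto
    then have "j - 1 < k" by simp
    from h [OF this] show ?thesis
      using \<open>1 \<le> j\<close> \<open>j \<le> k\<close> \<open>j - 1 < k\<close> by (auto simp: \<pi>_def exponents_nth)
  qed
  ultimately show "\<exists>\<pi>\<in>Inc. \<forall>j\<in>Poly_Mapping.keys b. Poly_Mapping.lookup b j \<le> Poly_Mapping.lookup m (\<pi> j)"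
    by blast
qed

section \<open>Action of \<open>Inc\<close> on monomials, and divisibility\<close>

lemma variable_power: "variable j ^ e = (Poly_Mapping.single (Poly_Mapping.single j e) 1 :: 'k::comm_ring_1 mpoly)"
  by (induction e) (simp_all add: variable_def mult_single single_add [symmetric])

lemma prod_single_one:
  "(\<Prod>j\<in>A. Poly_Mapping.single (f j) 1) = (Poly_Mapping.single (\<Sum>j\<in>A. f j) 1 :: 'k::comm_ring_1 mpoly)"
  by (induction A rule: infinite_finite_induct) (simp_all add: mult_single)

text \<open>The action on exponent vectors. As a sum it makes sense for every map: exponents sent to
  the same variable add up.\<close>

definition push :: "(nat \<Rightarrow> nat) \<Rightarrow> (nat \<Rightarrow>\<^sub>0 nat) \<Rightarrow> (nat \<Rightarrow>\<^sub>0 nat)" where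
  "push \<pi> m = (\<Sum>j\<in>Poly_Mapping.keys m. Poly_Mapping.single (\<pi> j) (Poly_Mapping.lookup m j))"

lemma act_single: "act \<pi> (Poly_Mapping.single m 1) = (Poly_Mapping.single (push \<pi> m) 1 :: 'k::comm_ring_1 mpoly)"
  by (simp add: act_def scalar_def variable_power prod_single_one push_def mult_single)

lemma lookup_push:
  assumes "inj_on \<pi> (Poly_Mapping.keys m)"
  shows "j \<in> Poly_Mapping.keys m \<Longrightarrow> Poly_Mapping.lookup (push \<pi> m) (\<pi> j) = Poly_Mapping.lookup m j"
    and "i \<notin> \<pi> ` Poly_Mapping.keys m \<Longrightarrow> Poly_Mapping.lookup (push \<pi> m) i = 0"
proof -
  assume j: "j \<in> Poly_Mapping.keys m"
  have "Poly_Mapping.lookup (push \<pi> m) (\<pi> j)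
      = (\<Sum>i\<in>Poly_Mapping.keys m. if i = j then Poly_Mapping.lookup m i else 0)"
    unfolding push_def lookup_sum lookup_single when_def
    using assms j by (intro sum.cong) (auto dest: inj_onD)
  with j show "Poly_Mapping.lookup (push \<pi> m) (\<pi> j) = Poly_Mapping.lookup m j" by simp
next
  assume "i \<notin> \<pi> ` Poly_Mapping.keys m"
  then show "Poly_Mapping.lookup (push \<pi> m) i = 0"
    unfolding push_def lookup_sum lookup_single when_def by (intro sum.neutral) auto
qed

lemma ex_add_iff_le:
  "(\<exists>q. m = g + q) \<longleftrightarrow> (\<forall>i. Poly_Mapping.lookup g i \<le> Poly_Mapping.lookup (m :: nat \<Rightarrow>\<^sub>0 nat) i)"
proof
  assume "\<forall>i. Poly_Mapping.lookup g i \<le> Poly_Mapping.lookup m i"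
  \<comment> \<open>The pointwise truncated subtraction is exact by assumption.\<close>
  then have "m = g + (m - g)"
    by (intro poly_mapping_eqI) (simp add: lookup_add lookup_minus)
  then show "\<exists>q. m = g + q" ..
qed (auto simp: lookup_add)

text \<open>Translates divisibility by an orbit element into a condition on the keys of
  \<open>b\<close>; outside their image \<open>push \<pi> b\<close> has exponent 0.\<close>

lemma push_dvd_iff:
  assumes "inj_on \<pi> (Poly_Mapping.keys b)"
  shows "(\<exists>q. m = push \<pi> b + q)
    \<longleftrightarrow> (\<forall>j\<in>Poly_Mapping.keys b. Poly_Mapping.lookup b j \<le> Poly_Mapping.lookup m (\<pi> j))"
  unfolding ex_add_iff_le
proof (intro iffI allI ballI)
  fix i assume *: "\<forall>j\<in>Poly_Mapping.keys b. Poly_Mapping.lookup b j \<le> Poly_Mapping.lookup m (\<pi> j)"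
  show "Poly_Mapping.lookup (push \<pi> b) i \<le> Poly_Mapping.lookup m i"
    using * lookup_push [OF assms] by (cases "i \<in> \<pi> ` Poly_Mapping.keys b") auto
next
  fix j assume "\<forall>i. Poly_Mapping.lookup (push \<pi> b) i \<le> Poly_Mapping.lookup m i" "j \<in> Poly_Mapping.keys b"
  then show "Poly_Mapping.lookup b j \<le> Poly_Mapping.lookup m (\<pi> j)"
    using lookup_push(1) [OF assms] by metis
qed

lemma keys_push: "Poly_Mapping.keys (push \<pi> m) \<subseteq> \<pi> ` Poly_Mapping.keys m"
  unfolding push_def by (rule order_trans [OF keys_sum]) auto

section \<open>Monomial ideals and their quotients\<close>

lemma poly_ring_simps:
  "carrier (poly_ring V) = {p. \<forall>m \<in> Poly_Mapping.keys p. \<forall>i \<in> Poly_Mapping.keys m. i \<in> V}"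
  "x \<otimes>\<^bsub>poly_ring V\<^esub> y = x * y" "x \<oplus>\<^bsub>poly_ring V\<^esub> y = x + y"
  "\<one>\<^bsub>poly_ring V\<^esub> = 1" "\<zero>\<^bsub>poly_ring V\<^esub> = 0"
  by (auto simp: poly_ring_def)

text \<open>Natural exponents cannot cancel, hence equality and not mere inclusion.\<close>

lemma keys_add_nat: "Poly_Mapping.keys (m + q :: nat \<Rightarrow>\<^sub>0 nat) = Poly_Mapping.keys m \<union> Poly_Mapping.keys q"
  by (auto simp: in_keys_iff lookup_add)

lemma keys_multE:
  assumes "m \<in> Poly_Mapping.keys (p * q)"
  obtains a b where "a \<in> Poly_Mapping.keys p" "b \<in> Poly_Mapping.keys q" "m = a + b"
  using keys_mult [of p q] assms by auto

lemma keys_subset_add: "Poly_Mapping.keys p \<subseteq> A \<Longrightarrow> Poly_Mapping.keys q \<subseteq> A \<Longrightarrow> Poly_Mapping.keys (p + q) \<subseteq> A"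
  using keys_add [of p q] by blast

lemma cring_poly_ring: "cring (poly_ring V :: 'k::comm_ring_1 mpoly ring)"
proof (rule cringI)
  show "abelian_group (poly_ring V :: 'k mpoly ring)"
  proof (rule abelian_groupI)
    show "\<exists>y\<in>carrier (poly_ring V). y \<oplus>\<^bsub>poly_ring V\<^esub> x = \<zero>\<^bsub>poly_ring V\<^esub>"
      if "x \<in> carrier (poly_ring V)" for x :: "'k mpoly"
      using that by (intro bexI [of _ "- x"]) (auto simp: poly_ring_simps)
  qed (use keys_add in \<open>fastforce simp: poly_ring_simps algebra_simps\<close>)+
  show "Group.comm_monoid (poly_ring V :: 'k mpoly ring)"
    by (rule comm_monoidI)
      (auto simp: poly_ring_simps algebra_simps keys_add_nat elim!: keys_multE)
qed (auto simp: poly_ring_simps algebra_simps)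

lemma a_inv_poly_ring:
  assumes "x \<in> carrier (poly_ring V)"
  shows "\<ominus>\<^bsub>poly_ring V\<^esub> x = - x"
proof -
  interpret cring "poly_ring V" by (rule cring_poly_ring)
  have "- x \<in> carrier (poly_ring V)" using assms by (auto simp: poly_ring_simps)
  then show ?thesis using assms by (intro minus_equality) (auto simp: poly_ring_simps)
qed

text \<open>The span of the monomials satisfying \<open>M\<close>. Since \<open>M\<close> is
  independent of \<open>V\<close>, truncation changes \<open>V\<close> only.\<close>

definition monomial_ideal :: "nat set \<Rightarrow> ((nat \<Rightarrow>\<^sub>0 nat) \<Rightarrow> bool) \<Rightarrow> 'k::comm_ring_1 mpoly set" where
  "monomial_ideal V M = {p \<in> carrier (poly_ring V). \<forall>m \<in> Poly_Mapping.keys p. M m}"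

lemma monomial_ideal_add:
  "p \<in> monomial_ideal V M \<Longrightarrow> q \<in> monomial_ideal V M \<Longrightarrow> p + q \<in> monomial_ideal V M"
  using keys_add [of p q] by (auto simp: monomial_ideal_def poly_ring_simps)

lemma monomial_ideal_uminus: "p \<in> monomial_ideal V M \<Longrightarrow> - p \<in> monomial_ideal V M"
  by (simp add: monomial_ideal_def poly_ring_simps)

lemma ideal_monomial_ideal:
  assumes "\<And>m q. M m \<Longrightarrow> M (m + q)"
  shows "ideal (monomial_ideal V M) (poly_ring V :: 'k::comm_ring_1 mpoly ring)"
proof (rule idealI)
  interpret cring "poly_ring V :: 'k mpoly ring" by (rule cring_poly_ring)
  show "ring (poly_ring V :: 'k mpoly ring)" by (rule ring_axioms)
  show "subgroup (monomial_ideal V M) (add_monoid (poly_ring V :: 'k mpoly ring))"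
  proof (rule add.subgroupI)
    show "monomial_ideal V M \<noteq> {}"
      by (auto simp: monomial_ideal_def poly_ring_simps intro!: exI [of _ 0])
    show "\<ominus>\<^bsub>poly_ring V\<^esub> a \<in> monomial_ideal V M" if "a \<in> monomial_ideal V M" for a :: "'k mpoly"
      using monomial_ideal_uminus [OF that] that a_inv_poly_ring [of a V]
      by (simp add: monomial_ideal_def)
  qed (auto simp: monomial_ideal_add poly_ring_simps, simp add: monomial_ideal_def poly_ring_simps)
  have mult: "x * a \<in> monomial_ideal V M"
    if "a \<in> monomial_ideal V M" "x \<in> carrier (poly_ring V)" for a x :: "'k mpoly"
    using that assms
    by (auto simp: monomial_ideal_def poly_ring_simps keys_add_nat elim!: keys_multE) (metis add.commute)
  then show "x \<otimes>\<^bsub>poly_ring V\<^esub> a \<in> monomial_ideal V M"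
    if "a \<in> monomial_ideal V M" "x \<in> carrier (poly_ring V)" for a x :: "'k mpoly"
    using that by (simp add: poly_ring_simps)
  show "a \<otimes>\<^bsub>poly_ring V\<^esub> x \<in> monomial_ideal V M"
    if "a \<in> monomial_ideal V M" "x \<in> carrier (poly_ring V)" for a x :: "'k mpoly"
    using mult [OF that] by (simp add: poly_ring_simps mult.commute)
qed

lemma sum_monomials: "p = (\<Sum>m\<in>Poly_Mapping.keys p. Poly_Mapping.single m (Poly_Mapping.lookup p m))"
proof (rule poly_mapping_eqI)
  fix k
  have "(\<Sum>m\<in>Poly_Mapping.keys p. Poly_Mapping.lookup (Poly_Mapping.single m (Poly_Mapping.lookup p m)) k)
      = (\<Sum>m\<in>Poly_Mapping.keys p. if m = k then Poly_Mapping.lookup p k else 0)"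
    by (rule sum.cong) (auto simp: lookup_single)
  then show "Poly_Mapping.lookup p k = Poly_Mapping.lookup
      (\<Sum>m\<in>Poly_Mapping.keys p. Poly_Mapping.single m (Poly_Mapping.lookup p m)) k"
    by (simp add: lookup_sum in_keys_iff)
qed

text \<open>The right side is an ideal containing the generators. Conversely, each term c x^(g + q)
  is c x^q times a generator, and a polynomial is the sum of its terms.\<close>

lemma genideal_monomials:
  assumes "\<And>g. g \<in> G \<Longrightarrow> Poly_Mapping.keys g \<subseteq> V"
  shows "Idl\<^bsub>poly_ring V\<^esub> ((\<lambda>g. Poly_Mapping.single g 1) ` G)
    = (monomial_ideal V (\<lambda>m. \<exists>g\<in>G. \<exists>q. m = g + q) :: 'k::comm_ring_1 mpoly set)"
    (is "?I = ?J")
proof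
  interpret cring "poly_ring V :: 'k mpoly ring" by (rule cring_poly_ring)
  let ?gens = "(\<lambda>g. Poly_Mapping.single g 1 :: 'k mpoly) ` G"
  have gens: "?gens \<subseteq> carrier (poly_ring V)"
    using assms by (fastforce simp: poly_ring_simps)
  then interpret I: ideal ?I "poly_ring V" by (rule genideal_ideal)
  show "?I \<subseteq> ?J"
  proof (rule genideal_minimal)
    show "ideal ?J (poly_ring V)"
      by (rule ideal_monomial_ideal) (metis add.assoc)
    show "?gens \<subseteq> ?J"
    proof
      fix x :: "'k mpoly" assume x: "x \<in> ?gens"
      then obtain g where g: "g \<in> G" "x = Poly_Mapping.single g 1" by blast
      have "\<exists>g'\<in>G. \<exists>q. g = g' + q"
        using g(1) by (intro bexI [of _ g] exI [of _ 0]) simp_all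
      then show "x \<in> ?J"
        using gens x unfolding monomial_ideal_def by (auto simp: g(2))
    qed
  qed
  show "?J \<subseteq> ?I"
  proof
    fix p assume p: "p \<in> ?J"
    have "Poly_Mapping.single m c \<in> ?I" if m: "m \<in> Poly_Mapping.keys p" for m c
    proof -
      obtain g q where g: "g \<in> G" and mgq: "m = g + q"
        using p m by (auto simp: monomial_ideal_def)
      \<comment> \<open>The cofactor has only variables of \<open>m\<close>, so it lies in the
        ring.\<close>
      have "Poly_Mapping.keys q \<subseteq> V"
        using p m unfolding mgq by (auto simp: monomial_ideal_def poly_ring_simps keys_add_nat)
      then have "Poly_Mapping.single q c \<in> carrier (poly_ring V)"
        by (auto simp: poly_ring_simps)
      moreover have "Poly_Mapping.single g 1 \<in> ?I"
        using genideal_self [OF gens] g by blast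
      ultimately have "Poly_Mapping.single q c * Poly_Mapping.single g 1 \<in> ?I"
        using I.I_l_closed by (simp add: poly_ring_simps)
      then show ?thesis by (simp add: mult_single mgq add.commute)
    qed
    note monom = this
    have sum: "(\<Sum>m\<in>A. f m) \<in> ?I" if "finite A" "\<And>m. m \<in> A \<Longrightarrow> f m \<in> ?I"
      for A and f :: "_ \<Rightarrow> 'k mpoly"
      using that
    proof induction
      case empty
      then show ?case using I.zero_closed by (simp add: poly_ring_simps)
    next
      case (insert x F)
      then show ?case using I.a_closed by (simp add: poly_ring_simps)
    qed
    show "p \<in> ?I"
      by (subst sum_monomials, rule sum [OF finite_keys]) (rule monom)
  qed
qed

lemma coset_poly_ring: "J +>\<^bsub>poly_ring V\<^esub> p = {h + p | h. h \<in> J}"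
  by (auto simp: a_r_coset_def r_coset_def poly_ring_def)

lemma monomial_coset_eq_iff:
  fixes p q :: "'k::comm_ring_1 mpoly"
  shows "monomial_ideal V M +>\<^bsub>poly_ring V\<^esub> p = monomial_ideal V M +>\<^bsub>poly_ring V\<^esub> q
    \<longleftrightarrow> p - q \<in> monomial_ideal V M"
proof
  have zero: "0 \<in> (monomial_ideal V M :: 'k mpoly set)"
    by (simp add: monomial_ideal_def poly_ring_simps)
  assume "monomial_ideal V M +>\<^bsub>poly_ring V\<^esub> p = monomial_ideal V M +>\<^bsub>poly_ring V\<^esub> q"
  moreover have "p \<in> monomial_ideal V M +>\<^bsub>poly_ring V\<^esub> p"
    unfolding coset_poly_ring using zero by (intro CollectI exI [of _ 0]) simp
  ultimately show "p - q \<in> monomial_ideal V M"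
    unfolding coset_poly_ring by auto
next
  have sub: "monomial_ideal V M +>\<^bsub>poly_ring V\<^esub> p \<subseteq> monomial_ideal V M +>\<^bsub>poly_ring V\<^esub> q"
    if "p - q \<in> monomial_ideal V M" for p q :: "'k mpoly"
  proof
    fix x assume "x \<in> monomial_ideal V M +>\<^bsub>poly_ring V\<^esub> p"
    then obtain h where "h \<in> monomial_ideal V M" "x = h + p"
      unfolding coset_poly_ring by blast
    then show "x \<in> monomial_ideal V M +>\<^bsub>poly_ring V\<^esub> q"
      unfolding coset_poly_ring
      using monomial_ideal_add [OF _ that, of h]
      by (intro CollectI exI [of _ "h + (p - q)"]) simp
  qed
  assume pq: "p - q \<in> monomial_ideal V M"
  show "monomial_ideal V M +>\<^bsub>poly_ring V\<^esub> p = monomial_ideal V M +>\<^bsub>poly_ring V\<^esub> q"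
    using sub [OF pq] sub [of q p] monomial_ideal_uminus [OF pq] by simp
qed

lemma scalar_mult_single: "scalar c * Poly_Mapping.single m d = Poly_Mapping.single m (c * d)"
  by (simp add: scalar_def mult_single)

lemma subfield_scalars: "subfield (range scalar) (poly_ring V :: 'k::field mpoly ring)"
proof -
  interpret cring "poly_ring V :: 'k mpoly ring" by (rule cring_poly_ring)
  have carr: "range scalar \<subseteq> carrier (poly_ring V :: 'k mpoly ring)"
    by (auto simp: scalar_def poly_ring_simps split: if_splits)
  show ?thesis
  proof (rule subfieldI)
    show "subcring (range scalar) (poly_ring V :: 'k mpoly ring)"
    proof (rule subcringI')
      show "subring (range scalar) (poly_ring V :: 'k mpoly ring)"
      proof (rule subringI [OF carr])
        show "\<one>\<^bsub>poly_ring V\<^esub> \<in> (range scalar :: 'k mpoly set)"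
          by (auto simp: scalar_def poly_ring_simps intro: image_eqI [of _ _ 1])
        fix h1 h2 :: "'k mpoly"
        assume h: "h1 \<in> range scalar"
        then have "h1 \<in> carrier (poly_ring V)" using carr by blast
        then show "\<ominus>\<^bsub>poly_ring V\<^esub> h1 \<in> range scalar"
          using h by (auto simp: a_inv_poly_ring scalar_def simp flip: single_uminus)
        assume "h2 \<in> range scalar"
        then show "h1 \<otimes>\<^bsub>poly_ring V\<^esub> h2 \<in> range scalar" "h1 \<oplus>\<^bsub>poly_ring V\<^esub> h2 \<in> range scalar"
          using h by (auto simp: scalar_def poly_ring_simps mult_single simp flip: single_add)
      qed
    qed
    \<comment> \<open>A scalar is recovered as its coefficient at the monomial 0, which reduces
      units to inverses in the field.\<close>
    have "scalar c \<noteq> 0 \<longleftrightarrow> c \<noteq> 0" for c :: 'k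
      by (metis lookup_single_eq lookup_zero scalar_def single_zero)
    moreover have "scalar c * scalar d = 1 \<longleftrightarrow> c * d = 1" for c d :: 'k
      unfolding scalar_def mult_single
      by (metis add_0 lookup_single_eq single_one)
    moreover have "\<exists>d. c * d = 1" if "c \<noteq> 0" for c :: 'k
      using right_inverse [OF that] by blast
    ultimately show "Units (poly_ring V \<lparr>carrier := range scalar\<rparr>) = range scalar - {\<zero>\<^bsub>poly_ring V\<^esub> :: 'k mpoly}"
      by (auto simp: Units_def poly_ring_simps mult.commute)
  qed
qed

section \<open>Dimension of the graded parts of a monomial quotient\<close>

context
  fixes V :: "nat set" and M :: "(nat \<Rightarrow>\<^sub>0 nat) \<Rightarrow> bool" and J :: "'k::field mpoly set"
  assumes M_add: "\<And>m q. M m \<Longrightarrow> M (m + q)" and not_M_0: "\<not> M 0"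
  defines "J \<equiv> monomial_ideal V M"
begin

lemma rcos_hom: "ring_hom_ring (poly_ring V) (poly_ring V Quot J) ((+>\<^bsub>poly_ring V\<^esub>) J)"
  unfolding J_def by (rule ideal.rcos_ring_hom_ring [OF ideal_monomial_ideal]) (rule M_add)

text \<open>\<open>\<not> M 0\<close> keeps 1 out of \<open>J\<close>, so the quotient is not the
  zero ring and the image of a subfield is again a subfield.\<close>

lemma subfield_quotient_scalars:
  "subfield (range (\<lambda>c. J +>\<^bsub>poly_ring V\<^esub> scalar c)) (poly_ring V Quot J)"
proof -
  interpret hom: ring_hom_ring "poly_ring V" "poly_ring V Quot J" "(+>\<^bsub>poly_ring V\<^esub>) J"
    by (rule rcos_hom)
  have "J +>\<^bsub>poly_ring V\<^esub> 1 \<noteq> J +>\<^bsub>poly_ring V\<^esub> 0"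
    unfolding J_def monomial_coset_eq_iff by (simp add: monomial_ideal_def not_M_0)
  then have "\<one>\<^bsub>poly_ring V Quot J\<^esub> \<noteq> \<zero>\<^bsub>poly_ring V Quot J\<^esub>"
    using hom.hom_one hom.hom_zero by (simp add: poly_ring_simps)
  then show ?thesis
    using hom.img_is_subfield(2) [OF subfield_scalars] by (simp add: image_image)
qed

text \<open>Monomials outside the ideal have independent classes: adjoining them one at a time, each
  extends the span by a line.\<close>

lemma dimension_monomials:
  assumes "finite S" "\<And>m. m \<in> S \<Longrightarrow> Poly_Mapping.keys m \<subseteq> V \<and> \<not> M m"
  shows "ring.dimension (poly_ring V Quot J) (card S)
    (range (\<lambda>c. J +>\<^bsub>poly_ring V\<^esub> scalar c))
    {J +>\<^bsub>poly_ring V\<^esub> p | p. Poly_Mapping.keys p \<subseteq> S}"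
  using assms
proof (induction S)
  interpret hom: ring_hom_ring "poly_ring V" "poly_ring V Quot J" "(+>\<^bsub>poly_ring V\<^esub>) J"
    by (rule rcos_hom)
  note [simp] = poly_ring_simps(2-)
  let ?\<phi> = "\<lambda>p. J +>\<^bsub>poly_ring V\<^esub> p"
  {
    case empty
    have "{?\<phi> p | p. Poly_Mapping.keys p \<subseteq> {}} = {\<zero>\<^bsub>poly_ring V Quot J\<^esub>}"
      using hom.hom_zero by auto
    then show ?case by simp
  next
    case (insert v S)
    let ?v = "Poly_Mapping.single v 1 :: 'k mpoly"
    let ?E = "{?\<phi> p | p. Poly_Mapping.keys p \<subseteq> S}"
    have v: "?v \<in> carrier (poly_ring V)" and sc: "scalar c \<in> carrier (poly_ring V)" for c :: 'k
      using insert.prems by (auto simp: poly_ring_simps scalar_def)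
    have carr: "p \<in> carrier (poly_ring V)" if "Poly_Mapping.keys p \<subseteq> S" for p :: "'k mpoly"
      using insert.prems that by (auto simp: poly_ring_simps)
    have comb: "?\<phi> (scalar c) \<otimes>\<^bsub>poly_ring V Quot J\<^esub> ?\<phi> ?v \<oplus>\<^bsub>poly_ring V Quot J\<^esub> ?\<phi> p
        = ?\<phi> (scalar c * ?v + p)" if "Poly_Mapping.keys p \<subseteq> S" for c p
      using hom.hom_mult [OF sc v] hom.hom_add [OF hom.R.m_closed [OF sc v] carr [OF that]]
      by simp
    \<comment> \<open>The monomial \<open>v\<close> survives in \<open>?v - p\<close> because
      \<open>p\<close> does not contain it; as \<open>v\<close> violates \<open>M\<close>, the
      difference is not in \<open>J\<close>.\<close>
    have "?\<phi> ?v \<notin> ?E"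
    proof
      assume "?\<phi> ?v \<in> ?E"
      then obtain p where p: "Poly_Mapping.keys p \<subseteq> S" "?v - p \<in> J"
        unfolding J_def by (auto simp: monomial_coset_eq_iff)
      have "Poly_Mapping.lookup p v = 0"
        using p(1) insert.hyps by (auto simp: in_keys_iff)
      then have "v \<in> Poly_Mapping.keys (?v - p)"
        by (subst in_keys_iff) (simp add: lookup_minus)
      with p(2) insert.prems show False by (auto simp: J_def monomial_ideal_def)
    qed
    moreover have "hom.S.line_extension (range (\<lambda>c. ?\<phi> (scalar c))) (?\<phi> ?v) ?E
        = {?\<phi> p | p. Poly_Mapping.keys p \<subseteq> insert v S}"
    proof (intro equalityI subsetI)
      fix u assume "u \<in> hom.S.line_extension (range (\<lambda>c. ?\<phi> (scalar c))) (?\<phi> ?v) ?E"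
      then obtain c p where u: "u = ?\<phi> (scalar c * ?v + p)" "Poly_Mapping.keys p \<subseteq> S"
        by (auto simp: hom.S.line_extension_mem_iff comb)
      then have "Poly_Mapping.keys (scalar c * ?v + p) \<subseteq> insert v S"
        by (intro keys_subset_add) (auto simp: scalar_mult_single)
      with u show "u \<in> {?\<phi> p | p. Poly_Mapping.keys p \<subseteq> insert v S}" by blast
    next
      fix u assume "u \<in> {?\<phi> p | p. Poly_Mapping.keys p \<subseteq> insert v S}"
      then obtain p where u: "u = ?\<phi> p" and p: "Poly_Mapping.keys p \<subseteq> insert v S" by blast
      \<comment> \<open>The coefficient of \<open>v\<close> gives the part along the new direction;
        the remainder is supported in \<open>S\<close>.\<close>
      define c where "c = Poly_Mapping.lookup p v"
      define q where "q = p - scalar c * ?v"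
      have q: "Poly_Mapping.keys q \<subseteq> S"
        using p by (auto simp: q_def c_def in_keys_iff lookup_minus scalar_mult_single lookup_single when_def split: if_splits)
      have "u = ?\<phi> (scalar c * ?v + q)" by (simp add: u q_def)
      then have "u = ?\<phi> (scalar c) \<otimes>\<^bsub>poly_ring V Quot J\<^esub> ?\<phi> ?v \<oplus>\<^bsub>poly_ring V Quot J\<^esub> ?\<phi> q"
        by (simp only: comb [OF q])
      then show "u \<in> hom.S.line_extension (range (\<lambda>c. ?\<phi> (scalar c))) (?\<phi> ?v) ?E"
        unfolding hom.S.line_extension_mem_iff using q by blast
    qed
    moreover have "hom.S.dimension (card S) (range (\<lambda>c. ?\<phi> (scalar c))) ?E"
      using insert by blast
    ultimately show ?case
      using hom.S.dimension.Suc_dim [OF hom.hom_closed [OF v]] insert.hyps by (metis (no_types, lifting) card_insert_disjoint)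
  }
qed

text \<open>Terms in \<open>J\<close> do not change a coset, so each class has a representative
  supported on monomials outside the ideal.\<close>

lemma graded_part_eq:
  "{J +>\<^bsub>poly_ring V\<^esub> p | p. p \<in> carrier (poly_ring V) \<and> homogeneous j p}
   = {J +>\<^bsub>poly_ring V\<^esub> p | p. Poly_Mapping.keys p \<subseteq> {m. Poly_Mapping.keys m \<subseteq> V \<and> mon_degree m = j \<and> \<not> M m}}"
  (is "?L = ?R")
proof
  show "?R \<subseteq> ?L" by (fastforce simp: poly_ring_simps homogeneous_def)
  show "?L \<subseteq> ?R"
  proof
    fix u assume "u \<in> ?L"
    then obtain p where u: "u = J +>\<^bsub>poly_ring V\<^esub> p" and p: "p \<in> carrier (poly_ring V)" "homogeneous j p"
      by blast
    \<comment> \<open>\<open>q\<close> is the normal form of \<open>p\<close>.\<close>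
    define q where "q = (\<Sum>m\<in>{m\<in>Poly_Mapping.keys p. \<not> M m}. Poly_Mapping.single m (Poly_Mapping.lookup p m))"
    have lookup_q: "Poly_Mapping.lookup q m = (if M m then 0 else Poly_Mapping.lookup p m)" for m
    proof -
      have "Poly_Mapping.lookup q m
          = (\<Sum>k\<in>{m\<in>Poly_Mapping.keys p. \<not> M m}. if k = m then Poly_Mapping.lookup p m else 0)"
        unfolding q_def lookup_sum by (rule sum.cong) (auto simp: lookup_single)
      then show ?thesis by (auto simp: in_keys_iff)
    qed
    have "p - q \<in> J"
      using p(1) by (auto simp: J_def monomial_ideal_def poly_ring_simps in_keys_iff lookup_minus lookup_q split: if_splits)
    then have "u = J +>\<^bsub>poly_ring V\<^esub> q"
      unfolding u J_def by (simp add: monomial_coset_eq_iff)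
    moreover have "Poly_Mapping.keys q \<subseteq> {m. Poly_Mapping.keys m \<subseteq> V \<and> mon_degree m = j \<and> \<not> M m}"
      using p by (auto simp: poly_ring_simps homogeneous_def in_keys_iff lookup_q split: if_splits)
    ultimately show "u \<in> ?R" by blast
  qed
qed

lemma dim_graded_part:
  assumes "finite {m. Poly_Mapping.keys m \<subseteq> V \<and> mon_degree m = j \<and> \<not> M m}"
  shows "ring.dim (poly_ring V Quot J) (range (\<lambda>c. J +>\<^bsub>poly_ring V\<^esub> scalar c))
      {J +>\<^bsub>poly_ring V\<^esub> p | p. p \<in> carrier (poly_ring V) \<and> homogeneous j p}
    = card {m. Poly_Mapping.keys m \<subseteq> V \<and> mon_degree m = j \<and> \<not> M m}"
proof -
  interpret hom: ring_hom_ring "poly_ring V" "poly_ring V Quot J" "(+>\<^bsub>poly_ring V\<^esub>) J"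
    by (rule rcos_hom)
  \<comment> \<open>\<open>dim\<close> is a definite description: the monomials give existence, and
    uniqueness holds over a subfield.\<close>
  show ?thesis
    unfolding hom.S.dim_def graded_part_eq
    using dimension_monomials [OF assms] hom.S.dimension_is_inj [OF subfield_quotient_scalars]
    by (intro the_equality) auto
qed

end

section \<open>The Hilbert series\<close>

lemma Inc_ideal_single:
  assumes "Poly_Mapping.keys b \<subseteq> {1..}"
  shows "Inc_ideal (Poly_Mapping.single b 1 :: 'k::comm_ring_1 mpoly)
    = monomial_ideal {1..} (\<lambda>m. \<exists>\<pi>\<in>Inc. \<exists>q. m = push \<pi> b + q)"
proof -
  have "Inc_ideal (Poly_Mapping.single b 1 :: 'k mpoly)
      = Idl\<^bsub>KX\<^esub> ((\<lambda>g. Poly_Mapping.single g 1) ` (\<lambda>\<pi>. push \<pi> b) ` Inc)"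
    unfolding Inc_ideal_def act_single by (rule arg_cong [where f = "genideal KX"]) auto
  also have "\<dots> = monomial_ideal {1..} (\<lambda>m. \<exists>g\<in>(\<lambda>\<pi>. push \<pi> b) ` Inc. \<exists>q. m = g + q)"
  proof (rule genideal_monomials)
    fix g assume "g \<in> (\<lambda>\<pi>. push \<pi> b) ` Inc"
    then obtain \<pi> where "\<pi> \<in> Inc" "Poly_Mapping.keys g \<subseteq> \<pi> ` Poly_Mapping.keys b"
      using keys_push by blast
    then show "Poly_Mapping.keys g \<subseteq> {1..}"
      using Inc_pos [of \<pi>] assms by fastforce
  qed
  finally show ?thesis by simp
qed

text \<open>Membership is decided monomial by monomial, so intersecting with
  \<open>KX_upto n\<close> only restricts the variables.\<close>

lemma trunc_monomial_ideal:
  "trunc_ideal (monomial_ideal {1..} M) n = monomial_ideal {1..n} M"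
  by (auto simp: trunc_ideal_def monomial_ideal_def poly_ring_simps)

lemma mon_degree_eq_sum_list:
  assumes "Poly_Mapping.keys m \<subseteq> {1..n}"
  shows "mon_degree m = sum_list (exponents n m)"
proof -
  have "sum_list (exponents n m) = (\<Sum>i\<in>{1..n}. Poly_Mapping.lookup m i)"
    by (simp add: exponents_def interv_sum_list_conv_sum_set_nat atLeastLessThanSuc_atLeastAtMost del: upt_Suc)
  also have "\<dots> = mon_degree m"
    unfolding mon_degree_def using assms by (intro sum.mono_neutral_right) (auto simp: in_keys_iff)
  finally show ?thesis ..
qed

lemma bij_betw_exponents:
  "bij_betw (exponents n) {m. Poly_Mapping.keys m \<subseteq> {1..n}} {xs. length xs = n}"
proof (intro bij_betwI')
  fix m m' :: "nat \<Rightarrow>\<^sub>0 nat"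
  assume "m \<in> {m. Poly_Mapping.keys m \<subseteq> {1..n}}" "m' \<in> {m. Poly_Mapping.keys m \<subseteq> {1..n}}"
  then have m: "Poly_Mapping.lookup m i = 0 \<and> Poly_Mapping.lookup m' i = 0" if "i \<notin> {1..n}" for i
    using that by (auto simp: in_keys_iff)
  show "(exponents n m = exponents n m') = (m = m')"
  proof
    assume eq: "exponents n m = exponents n m'"
    show "m = m'"
    proof (rule poly_mapping_eqI)
      fix i
      show "Poly_Mapping.lookup m i = Poly_Mapping.lookup m' i"
      proof (cases "i \<in> {1..n}")
        case True
        then have "i - 1 < n" "Suc (i - 1) = i" by auto
        then show ?thesis using eq exponents_nth by metis
      qed (use m in simp)
    qed
  qed simp
next
  fix xs :: "nat list" assume "xs \<in> {xs. length xs = n}"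
  then have len: "length xs = n" by simp
  define m where "m = (\<Sum>i<n. Poly_Mapping.single (Suc i) (xs ! i))"
  have "Poly_Mapping.lookup m (Suc k) = xs ! k" if "k < n" for k
  proof -
    have "Poly_Mapping.lookup m (Suc k) = (\<Sum>i<n. if i = k then xs ! k else 0)"
      unfolding m_def lookup_sum by (rule sum.cong) (auto simp: lookup_single)
    with that show ?thesis by simp
  qed
  then have "exponents n m = xs"
    by (intro nth_equalityI) (simp_all add: length_exponents exponents_nth len)
  moreover have "Poly_Mapping.keys m \<subseteq> {1..n}"
    unfolding m_def by (rule order_trans [OF keys_sum]) (auto split: if_splits)
  ultimately show "\<exists>m\<in>{m. Poly_Mapping.keys m \<subseteq> {1..n}}. xs = exponents n m" by blast
qed (simp add: length_exponents)

text \<open>Each coefficient counts monomials outside the ideal, and \<open>exponents\<close>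
  carries these bijectively to the words avoiding that of \<open>b\<close>.\<close>

lemma hilbert_series_Inc_ideal:
  assumes "Poly_Mapping.lookup b k \<noteq> 0" "Poly_Mapping.keys b \<subseteq> {1..k}"
  shows "hilbert_series (Inc_ideal (Poly_Mapping.single b 1 :: 'k::field mpoly))
    = word_gf (\<lambda>xs. \<not> list_emb (\<le>) (exponents k b) xs)"
proof (intro fps_ext)
  fix n j
  define M where "M = (\<lambda>m. \<exists>\<pi>\<in>Inc. \<exists>q. m = push \<pi> b + q)"
  have M_iff: "M m \<longleftrightarrow>
      (\<exists>\<pi>\<in>Inc. \<forall>j\<in>Poly_Mapping.keys b. Poly_Mapping.lookup b j \<le> Poly_Mapping.lookup m (\<pi> j))" for m
    unfolding M_def
  proof (rule bex_cong [OF refl])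
    fix \<pi> assume "\<pi> \<in> Inc"
    then have "strict_mono_on {1..k} \<pi>"
      by (intro strict_mono_onI) (auto intro: Inc_less)
    then have "inj_on \<pi> (Poly_Mapping.keys b)"
      using assms(2) strict_mono_on_imp_inj_on inj_on_subset by blast
    then show "(\<exists>q. m = push \<pi> b + q) \<longleftrightarrow>
        (\<forall>j\<in>Poly_Mapping.keys b. Poly_Mapping.lookup b j \<le> Poly_Mapping.lookup m (\<pi> j))"
      by (rule push_dvd_iff)
  qed
  have M_add: "M (m + q)" if "M m" for m q
    using that unfolding M_def by (metis add.assoc)
  \<comment> \<open>Every orbit element has the positive exponent of \<open>b\<close> at
    \<open>k\<close>, so none divides 1.\<close>
  have not_M_0: "\<not> M 0"
    using assms(1) unfolding M_iff by (force simp: in_keys_iff)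
  let ?S = "{m. Poly_Mapping.keys m \<subseteq> {1..n} \<and> mon_degree m = j \<and> \<not> M m}"
  let ?W = "{xs. length xs = n \<and> sum_list xs = j \<and> \<not> list_emb (\<le>) (exponents k b) xs}"
  have M_emb: "M m \<longleftrightarrow> list_emb (\<le>) (exponents k b) (exponents n m)"
    if "Poly_Mapping.keys m \<subseteq> {1..n}" for m
    unfolding M_iff using assms that by (rule ex_Inc_iff_list_emb)
  have "exponents n ` ?S = ?W"
  proof -
    have "?W = exponents n ` {m. Poly_Mapping.keys m \<subseteq> {1..n}}
        \<inter> {xs. sum_list xs = j \<and> \<not> list_emb (\<le>) (exponents k b) xs}"
      unfolding bij_betw_imp_surj_on [OF bij_betw_exponents] by auto
    also have "\<dots> = exponents n ` {m \<in> {m. Poly_Mapping.keys m \<subseteq> {1..n}}.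
        sum_list (exponents n m) = j \<and> \<not> list_emb (\<le>) (exponents k b) (exponents n m)}"
      by auto
    also have "{m \<in> {m. Poly_Mapping.keys m \<subseteq> {1..n}}.
        sum_list (exponents n m) = j \<and> \<not> list_emb (\<le>) (exponents k b) (exponents n m)} = ?S"
      unfolding mem_Collect_eq
      by (intro Collect_cong conj_cong refl) (simp_all only: M_emb mon_degree_eq_sum_list)
    finally show ?thesis ..
  qed
  then have bij: "bij_betw (exponents n) ?S ?W"
    by (intro bij_betw_subset [OF bij_betw_exponents]) auto
  then have "finite ?S"
    using bij_betw_finite [OF bij] finite_words by simp
  then have "ring.dim (poly_ring {1..n} Quot monomial_ideal {1..n} M)
      (range (\<lambda>c. monomial_ideal {1..n} M +>\<^bsub>poly_ring {1..n}\<^esub> scalar c))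
      {monomial_ideal {1..n} M +>\<^bsub>poly_ring {1..n}\<^esub> p | p :: 'k mpoly.
        p \<in> carrier (poly_ring {1..n}) \<and> homogeneous j p} = card ?S"
    by (intro dim_graded_part M_add not_M_0)
  moreover have "Inc_ideal (Poly_Mapping.single b 1 :: 'k mpoly) = monomial_ideal {1..} M"
    unfolding M_def using assms(2) by (intro Inc_ideal_single) auto
  ultimately show "hilbert_series (Inc_ideal (Poly_Mapping.single b 1 :: 'k mpoly)) $ n $ j
      = word_gf (\<lambda>xs. \<not> list_emb (\<le>) (exponents k b) xs) $ n $ j"
    using bij_betw_same_card [OF bij]
    by (simp add: hilbert_series_def word_gf_def trunc_quot_def scalars_def graded_part_def
        trunc_monomial_ideal full_SetCompr_eq del: One_nat_def)
qed

text \<open>The equivalence in \<open>g'\<close> makes \<open>g\<close> the unique quotient of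
  \<open>N\<close> by 1 - t - s. The subtraction \<open>\<mu> r - r\<close> is exact because the
  \<open>\<mu> i\<close> are \<open>r\<close> distinct positive integers up to
  \<open>\<mu> r\<close>.\<close>

theorem theorem2p4:
  fixes r :: nat and \<mu> a :: "nat \<Rightarrow> nat" and I :: "'k::field mpoly set"
    and D N :: "int poly poly"
  assumes "1 \<le> r"
    and "\<forall>i \<in> {1..r}. 1 \<le> \<mu> i"
    and "strict_mono_on {1..r} \<mu>"
    and "\<forall>i \<in> {1..r}. 1 \<le> a i"
  defines "I \<equiv> Inc_ideal (\<Prod>i = 1..r. variable (\<mu> i) ^ a i)"
    and "D \<equiv> (1 - var_t) ^ (\<mu> r - 1) *
              (\<Prod>i = 1..r. 1 - var_s * (\<Sum>k<a i. var_t ^ k))"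
    and "N \<equiv> (1 - var_t) ^ (\<mu> r - r) *
              (\<Prod>i = 1..r. 1 - var_t - var_s + var_s * var_t ^ a i) -
              var_s ^ \<mu> r * var_t ^ (\<Sum>i = 1..r. a i)"
  shows "\<exists>g :: int poly poly.
           (\<forall>g'. g' * (1 - var_t - var_s) = N \<longleftrightarrow> g' = g) \<and>
           hilbert_series I = bivariate_fps g / bivariate_fps D \<and>
           coprime g D"
proof -
  define b where "b = (\<Sum>i = 1..r. Poly_Mapping.single (\<mu> i) (a i))"
  define w where "w = 1 - var_t - var_s"
  \<comment> \<open>\<open>f c\<close> is the factor of a letter \<open>c\<close> in
    \<open>word_gf_emb\<close>, as a polynomial.\<close>
  define f where "f c = (1 - var_t) * (1 - var_s * (\<Sum>k<c. var_t ^ k))" for c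
  let ?A = "\<Sum>i = 1..r. a i"
  have inj: "inj_on \<mu> {1..r}"
    using assms(3) by (rule strict_mono_on_imp_inj_on)
  have le: "\<mu> i \<le> \<mu> r" if "i \<in> {1..r}" for i
    using strict_mono_onD [OF assms(3), of i r] that by (cases "i = r") auto
  have sub: "\<mu> ` {1..r} \<subseteq> {1..\<mu> r}"
    using le assms(2) by auto
  then have "card (\<mu> ` {1..r}) \<le> card {1..\<mu> r}"
    by (intro card_mono) auto
  then have r_le: "r \<le> \<mu> r"
    unfolding card_image [OF inj] by simp
  have lookup_b: "Poly_Mapping.lookup b (\<mu> i) = a i" if "i \<in> {1..r}" for i
  proof -
    have "Poly_Mapping.lookup b (\<mu> i) = (\<Sum>k = 1..r. if k = i then a i else 0)"
      unfolding b_def lookup_sum using inj that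
      by (intro sum.cong) (auto simp: lookup_single when_def dest: inj_onD)
    with that show ?thesis by simp
  qed
  have lookup_b_0: "Poly_Mapping.lookup b k = 0" if "k \<notin> \<mu> ` {1..r}" for k
    unfolding b_def lookup_sum using that by (intro sum.neutral) (auto simp: lookup_single when_def)
  have b_top: "Poly_Mapping.lookup b (\<mu> r) \<noteq> 0"
    using lookup_b [of r] bspec [OF assms(4), of r] assms(1) by simp
  have keys_b: "Poly_Mapping.keys b \<subseteq> {1..\<mu> r}"
    using lookup_b_0 sub by (auto simp: in_keys_iff)
  have sum_b: "sum_list (exponents (\<mu> r) b) = ?A"
  proof -
    have "sum_list (exponents (\<mu> r) b) = (\<Sum>k\<in>\<mu> ` {1..r}. Poly_Mapping.lookup b k)"
      unfolding mon_degree_eq_sum_list [OF keys_b, symmetric] mon_degree_def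
      using lookup_b_0 by (intro sum.mono_neutral_left) (auto simp: in_keys_iff)
    also have "\<dots> = ?A"
      unfolding sum.reindex [OF inj] comp_def by (rule sum.cong [OF refl lookup_b])
    finally show ?thesis .
  qed
  have f_eq: "f c = 1 - var_t - var_s + var_s * var_t ^ c" for c
  proof -
    have "f c = 1 - var_t - var_s * ((1 - var_t) * (\<Sum>k<c. var_t ^ k))"
      by (simp add: f_def algebra_simps)
    then show ?thesis
      unfolding one_diff_power_eq [symmetric] by (simp add: algebra_simps)
  qed
  \<comment> \<open>The \<open>\<mu> r - r\<close> indices not among the \<open>\<mu> i\<close>
    carry the letter 0, and \<open>f 0\<close> is 1 - t because its inner sum is empty.\<close>
  have prod_b: "(\<Prod>c\<leftarrow>exponents (\<mu> r) b. f c) = (1 - var_t) ^ (\<mu> r - r) * (\<Prod>i = 1..r. f (a i))"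
  proof -
    have "(\<Prod>c\<leftarrow>exponents (\<mu> r) b. f c) = (\<Prod>k\<in>{1..\<mu> r}. f (Poly_Mapping.lookup b k))"
      by (simp add: exponents_def comp_def prod.distinct_set_conv_list [symmetric]
          atLeastLessThanSuc_atLeastAtMost del: upt_Suc)
    also have "\<dots> = (\<Prod>k\<in>{1..\<mu> r} - \<mu> ` {1..r}. f (Poly_Mapping.lookup b k))
        * (\<Prod>k\<in>\<mu> ` {1..r}. f (Poly_Mapping.lookup b k))"
      using sub by (intro prod.subset_diff) auto
    also have "(\<Prod>k\<in>{1..\<mu> r} - \<mu> ` {1..r}. f (Poly_Mapping.lookup b k)) = (1 - var_t) ^ (\<mu> r - r)"
      using sub by (simp add: lookup_b_0 f_def card_Diff_subset card_image [OF inj] del: One_nat_def)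
    also have "(\<Prod>k\<in>\<mu> ` {1..r}. f (Poly_Mapping.lookup b k)) = (\<Prod>i = 1..r. f (a i))"
      unfolding prod.reindex [OF inj] comp_def by (intro prod.cong refl) (simp only: lookup_b)
    finally show ?thesis .
  qed
  define Q where "Q = (\<Prod>c\<leftarrow>exponents (\<mu> r) b. f c)"
  have N: "N = Q - var_s ^ \<mu> r * var_t ^ ?A"
    unfolding N_def Q_def prod_b f_eq ..
  \<comment> \<open>Each of the \<open>\<mu> r\<close> letters gives a factor 1 - t, one more than
    \<open>D\<close> has.\<close>
  have Q: "Q = (1 - var_t) * D"
  proof -
    have "Q = ((1 - var_t) ^ (\<mu> r - r) * (1 - var_t) ^ r) * (\<Prod>i = 1..r. 1 - var_s * (\<Sum>k<a i. var_t ^ k))"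
      unfolding Q_def prod_b by (simp add: f_def prod.distrib)
    also have "(1 - var_t) ^ (\<mu> r - r) * (1 - var_t) ^ r = (1 - var_t) * (1 - var_t) ^ (\<mu> r - 1)"
      using r_le assms(1) by (simp flip: power_add power_Suc)
    finally show ?thesis by (simp only: D_def mult.assoc)
  qed
  have "w dvd N"
    unfolding w_def N_def by (rule one_minus_t_minus_s_dvd [OF r_le])
  then obtain g where g: "N = g * w" by (metis dvdE mult.commute)
  have nz: "w \<noteq> 0" "1 - var_t \<noteq> 0"
    by (auto simp: w_def var_t_def var_s_def one_pCons)
  have "\<forall>g'. g' * (1 - var_t - var_s) = N \<longleftrightarrow> g' = g"
    using nz(1) unfolding g w_def [symmetric] by simp
  moreover have "hilbert_series I = bivariate_fps g / bivariate_fps D"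
  proof (rule fps_fps_eq_divideI)
    have "(\<Prod>i = 1..r. variable (\<mu> i) ^ a i) = (Poly_Mapping.single b 1 :: 'k mpoly)"
      by (simp add: variable_power prod_single_one b_def)
    then have H: "hilbert_series I = word_gf (\<lambda>xs. \<not> list_emb (\<le>) (exponents (\<mu> r) b) xs)"
      unfolding I_def using hilbert_series_Inc_ideal [OF b_top keys_b] by metis
    have "bivariate_fps (prod_list ps) = (\<Prod>p\<leftarrow>ps. bivariate_fps p)" for ps
      by (induction ps) (simp_all add: bivariate_fps_hom)
    then have "(\<Prod>c\<leftarrow>exponents (\<mu> r) b. (1 - fps_t) * (1 - fps_s * (\<Sum>k<c. fps_t ^ k))) = bivariate_fps Q"
      by (simp add: Q_def f_def bivariate_fps_hom comp_def)
    then have "hilbert_series I * bivariate_fps w * bivariate_fps Q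
        = bivariate_fps (1 - var_t) * bivariate_fps N"
      using word_gf_not_emb [of "exponents (\<mu> r) b"]
      by (simp add: H N w_def bivariate_fps_hom sum_b length_exponents)
    \<comment> \<open>The common factor (1 - t)(1 - t - s) is isolated here in order to be
      cancelled.\<close>
    then have "(bivariate_fps (1 - var_t) * bivariate_fps w) * (hilbert_series I * bivariate_fps D)
        = (bivariate_fps (1 - var_t) * bivariate_fps w) * bivariate_fps g"
      unfolding Q g bivariate_fps_mult by (simp only: mult_ac)
    moreover have "bivariate_fps (1 - var_t) \<noteq> 0" "bivariate_fps w \<noteq> 0"
      using nz injD [OF inj_bivariate_fps] bivariate_fps_0 by metis+
    ultimately show "hilbert_series I * bivariate_fps D = bivariate_fps g" by simp
    \<comment> \<open>At s = t = 0 every factor of \<open>D\<close> is 1.\<close>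
    have "poly (poly D 0) 0 = 1"
      by (simp add: D_def poly_prod var_s_def var_t_def)
    then show "bivariate_fps D $ 0 $ 0 \<noteq> 0"
      by (simp add: bivariate_fps_nth poly_0_coeff_0)
  qed
  moreover have "coprime g D"
  proof -
    \<comment> \<open>Since \<open>Q\<close> is (1 - t) \<open>D\<close>, the polynomial 1 - t and
      every factor of \<open>D\<close> divide the right side, as both coprimality lemmas
      require.\<close>
    have Q_eq: "Q = g * w + var_s ^ \<mu> r * var_t ^ ?A"
      using N g by simp
    have "coprime g (1 - var_t)"
      using r_le assms(1) Q Q_eq unfolding w_def
      by (intro coprime_one_minus_var_t [of "\<mu> r" _ ?A]) (auto intro: dvdI)
    moreover have "coprime g (1 - var_s * (\<Sum>k<a i. var_t ^ k))" if "i \<in> {1..r}" for i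
    proof (rule coprime_one_minus_var_s_mult [of _ _ w "\<mu> r" ?A])
      have "1 - var_s * (\<Sum>k<a i. var_t ^ k) dvd D"
        unfolding D_def using that by (intro dvd_mult dvd_prodI) auto
      then show "1 - var_s * (\<Sum>k<a i. var_t ^ k) dvd g * w + var_s ^ \<mu> r * var_t ^ ?A"
        unfolding Q_eq [symmetric] Q by (rule dvd_mult)
    qed
    ultimately show ?thesis
      unfolding D_def
      by (intro coprime_mult_right_iff [THEN iffD2] conjI prod_coprime_right)
        (auto simp only: coprime_power_right_iff)
  qed
  ultimately show ?thesis by blast
qed

end
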